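(* Let PSolver be a partial solver for parity games such that, whenever it is called on a game structure with vertex set $V$, edge set $E$ and players' vertex sets $V_0,V_1$, the sets $Z_0,Z_1$ it returns satisfy, with $\overline{V} = V\setminus(Z_0\cup Z_1)$: for all $(v,v')\in E$ and $i\in\{0,1\}$, if $v\in\overline{V}\cap V_i$ and $v'\notin\overline{V}$, then $v'\in Z_{1-i}$. Then, for every parity game $(G,\mathsf{EvenParity}(\alpha))$, the recursive algorithm $\mathrm{Ziel\&PSolver}(G,\alpha)$ (defined in the context) correctly computes the winning sets of both players, i.e. the sets $W_0, W_1$ it returns satisfy $W_i = \mathsf{Win}(G,i,i\mathsf{Parity}(\alpha))$ for $i\in\{0,1\}$.
   Context: A game structure $G=(V_0,V_1,E)$ consists of a finite directed graph $(V,E)$ with $V=V_0\sqcup V_1$ ($V_i$ is the set of vertices controlled by player $i$), such that every vertex has at least one outgoing edge. For $U\subseteq V$, the restriction $(V_0\cap U,V_1\cap U,E\cap(U\times U))$ is called a subgame structure if each of its vertices has a successor in it (the empty restriction is allowed); $G\setminus U$ denotes the restriction to $V\setminus U$. Plays are infinite paths in $G$. A strategy of player $i$ maps each history (finite path) ending in $V_i$ to a successor of its last vertex. For an objective $\Omega$ (a set of plays), $\mathsf{Win}(G,i,\Omega)$ is the set of vertices $v_0$ from which player $i$ has a strategy such that all plays from $v_0$ consistent with it belong to $\Omega$. Given a priority function $\alpha:V\to\{0,\dots,d\}$, $\mathsf{EvenParity}(\alpha)=0\mathsf{Parity}(\alpha)$ (objective of player 0) is the set of plays whose maximum priority seen infinitely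 often is even, and $\mathsf{OddParity}(\alpha)=1\mathsf{Parity}(\alpha)$ (objective of player 1) is the set of plays whose maximum priority seen infinitely often is odd. The attractor $\mathsf{Attr}_i(G,U)$ is the set of vertices from which player $i$ can ensure to visit $U$ in any number of steps (zero included). A partial solver for parity games is an algorithm that, given $(G,\alpha)$, returns sets $Z_0\subseteq\mathsf{Win}(G,0,\mathsf{EvenParity}(\alpha))$ and $Z_1\subseteq\mathsf{Win}(G,1,\mathsf{OddParity}(\alpha))$ such that the restriction of $G$ to $V\setminus(Z_0\cup Z_1)$ is a subgame structure. Algorithm $\mathrm{Ziel\&PSolver}(G,\alpha)$, returning sets $W_0,W_1$ indexed by players (on subgames, $\alpha$ is restricted): 1. If $V=\emptyset$, return $W_0=W_1=\emptyset$. 2. Otherwise, let $Z_0,Z_1$ be the sets returned by $\mathrm{PSolver}(G,\alpha)$, $\overline{G}=G\setminus(Z_0\cup Z_1)$, $\overline{V}=V\setminus(Z_0\cup Z_1)$. If $\overline{V}=\emptyset$, return $W_0=Z_0$, $W_1=Z_1$. 3. Otherwise let $p=\max\{\alpha(v)\mid v\in\overline{V}\}$, $i=p\bmod 2$, $U=\{v\in\overline{V}\mid\alpha(v)=p\}$, $X=\mathsf{Attr}_i(\overline{G},U)$, and let $W'_i,W'_{1-i}$ be the sets returned for players $i$ and $1-i$ by $\mathrm{Ziel\&PSolver}(\overline{G}\setminus X,\alpha)$. 4. If $W'_{1-i}=\emptyset$, return $W_i=Z_i\cup W'_i\cup X$ and $W_{1-i}=Z_{1-i}$. 5. Otherwise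 let $X=\mathsf{Attr}_{1-i}(\overline{G},W'_{1-i})$ (redefining $X$), let $W''_i,W''_{1-i}$ be the sets returned by $\mathrm{Ziel\&PSolver}(\overline{G}\setminus X,\alpha)$, and return $W_i=Z_i\cup W''_i$ and $W_{1-i}=Z_{1-i}\cup W''_{1-i}\cup X$. *)

theory Defs
  imports "HOL-Library.FuncSet" "HOL-Library.Infinite_Set" "HOL-Library.Monad_Syntax"
begin

section \<open>Game structures\<close>

datatype player = P0 | P1

fun opponent :: "player \<Rightarrow> player" where
  "opponent P0 = P1"
| "opponent P1 = P0"

text \<open>The player whose index is \<open>p mod 2\<close>.\<close>

definition player_of :: "nat \<Rightarrow> player" where
  "player_of p = (if p mod 2 = 0 then P0 else P1)"

record 'v game =
  owned :: "player \<Rightarrow> 'v set"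
  edges :: "('v \<times> 'v) set"

definition verts :: "'v game \<Rightarrow> 'v set" where
  "verts G = owned G P0 \<union> owned G P1"

definition game_structure :: "'v game \<Rightarrow> bool" where
  "game_structure G \<longleftrightarrow>
     finite (verts G) \<and> owned G P0 \<inter> owned G P1 = {} \<and>
     edges G \<subseteq> verts G \<times> verts G \<and>
     (\<forall>v\<in>verts G. \<exists>v'. (v, v') \<in> edges G)"

definition restriction :: "'v game \<Rightarrow> 'v set \<Rightarrow> 'v game" where
  "restriction G U = \<lparr>owned = (\<lambda>i. owned G i \<inter> U), edges = edges G \<inter> (U \<times> U)\<rparr>"

definition subgame_structure :: "'v game \<Rightarrow> 'v set \<Rightarrow> bool" where
  "subgame_structure G U \<longleftrightarrow>
     U \<subseteq> verts G \<and>
     (\<forall>v\<in>verts (restriction G U). \<exists>v'. (v, v') \<in> edges (restriction G U))"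

definition remove :: "'v game \<Rightarrow> 'v set \<Rightarrow> 'v game" where
  "remove G U = restriction G (verts G - U)"


section \<open>Plays, strategies and winning sets\<close>

definition play :: "'v game \<Rightarrow> (nat \<Rightarrow> 'v) \<Rightarrow> bool" where
  "play G \<pi> \<longleftrightarrow> (\<forall>n. \<pi> n \<in> verts G \<and> (\<pi> n, \<pi> (Suc n)) \<in> edges G)"

definition history :: "'v game \<Rightarrow> 'v list \<Rightarrow> bool" where
  "history G h \<longleftrightarrow>
     h \<noteq> [] \<and> set h \<subseteq> verts G \<and>
     (\<forall>n. Suc n < length h \<longrightarrow> (h ! n, h ! Suc n) \<in> edges G)"

text \<open>Only the values of a strategy on histories ending in a vertex of player \<open>i\<close> matter.\<close>

definition strategy :: "'v game \<Rightarrow> player \<Rightarrow> ('v list \<Rightarrow> 'v) \<Rightarrow> bool" where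
  "strategy G i \<sigma> \<longleftrightarrow>
     (\<forall>h. history G h \<and> last h \<in> owned G i \<longrightarrow> (last h, \<sigma> h) \<in> edges G)"

definition consistent :: "'v game \<Rightarrow> player \<Rightarrow> ('v list \<Rightarrow> 'v) \<Rightarrow> (nat \<Rightarrow> 'v) \<Rightarrow> bool" where
  "consistent G i \<sigma> \<pi> \<longleftrightarrow>
     (\<forall>n. \<pi> n \<in> owned G i \<longrightarrow> \<pi> (Suc n) = \<sigma> (map \<pi> [0..<Suc n]))"

definition Win :: "'v game \<Rightarrow> player \<Rightarrow> (nat \<Rightarrow> 'v) set \<Rightarrow> 'v set" where
  "Win G i \<Omega> =
     {v \<in> verts G. \<exists>\<sigma>. strategy G i \<sigma> \<and>
        (\<forall>\<pi>. play G \<pi> \<and> \<pi> 0 = v \<and> consistent G i \<sigma> \<pi> \<longrightarrow> \<pi> \<in> \<Omega>)}"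

definition Reach :: "'v game \<Rightarrow> 'v set \<Rightarrow> (nat \<Rightarrow> 'v) set" where
  "Reach G U = {\<pi>. play G \<pi> \<and> (\<exists>n. \<pi> n \<in> U)}"

definition Attr :: "'v game \<Rightarrow> player \<Rightarrow> 'v set \<Rightarrow> 'v set" where
  "Attr G i U = Win G i (Reach G U)"


section \<open>Parity games\<close>

text \<open>
  A priority function on a vertex set is represented by its extensional version, so that
  a restricted priority function carries no information about the removed vertices.
\<close>

definition parity_game :: "'v game \<Rightarrow> ('v \<Rightarrow> nat) \<Rightarrow> bool" where
  "parity_game G \<alpha> \<longleftrightarrow> game_structure G \<and> (\<exists>d. \<alpha> \<in> verts G \<rightarrow>\<^sub>E {0..d})"

text \<open>On plays of a finite game the maximum is over a finite nonempty set.\<close>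

definition max_inf_priority :: "('v \<Rightarrow> nat) \<Rightarrow> (nat \<Rightarrow> 'v) \<Rightarrow> nat" where
  "max_inf_priority \<alpha> \<pi> = Max {p. \<exists>\<^sub>\<infinity>n. \<alpha> (\<pi> n) = p}"

definition EvenParity :: "'v game \<Rightarrow> ('v \<Rightarrow> nat) \<Rightarrow> (nat \<Rightarrow> 'v) set" where
  "EvenParity G \<alpha> = {\<pi>. play G \<pi> \<and> even (max_inf_priority \<alpha> \<pi>)}"

definition OddParity :: "'v game \<Rightarrow> ('v \<Rightarrow> nat) \<Rightarrow> (nat \<Rightarrow> 'v) set" where
  "OddParity G \<alpha> = {\<pi>. play G \<pi> \<and> odd (max_inf_priority \<alpha> \<pi>)}"

fun Parity :: "player \<Rightarrow> 'v game \<Rightarrow> ('v \<Rightarrow> nat) \<Rightarrow> (nat \<Rightarrow> 'v) set" where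
  "Parity P0 G \<alpha> = EvenParity G \<alpha>"
| "Parity P1 G \<alpha> = OddParity G \<alpha>"


section \<open>Partial solvers and the recursive algorithm\<close>

type_synonym 'v solver = "'v game \<Rightarrow> ('v \<Rightarrow> nat) \<Rightarrow> player \<Rightarrow> 'v set"

definition partial_solver :: "'v solver \<Rightarrow> bool" where
  "partial_solver PSolver \<longleftrightarrow>
     (\<forall>G \<alpha>. parity_game G \<alpha> \<longrightarrow>
        PSolver G \<alpha> P0 \<subseteq> Win G P0 (EvenParity G \<alpha>) \<and>
        PSolver G \<alpha> P1 \<subseteq> Win G P1 (OddParity G \<alpha>) \<and>
        subgame_structure G (verts G - (PSolver G \<alpha> P0 \<union> PSolver G \<alpha> P1)))"

text \<open>
  The result \<open>Some W\<close> means that the algorithm terminates and returns \<open>W P0\<close> and \<open>W P1\<close>;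
  as \<open>ziel_psolver\<close> is the least fixed point, \<open>None\<close> means that it does not terminate.
\<close>

partial_function (option) ziel_psolver ::
  "'v solver \<Rightarrow> 'v game \<Rightarrow> ('v \<Rightarrow> nat) \<Rightarrow> (player \<Rightarrow> 'v set) option" where
  "ziel_psolver PSolver G \<alpha> =
    (if verts G = {} then Some (\<lambda>_. {})
     else
       let Z = PSolver G \<alpha>;
           G' = remove G (Z P0 \<union> Z P1)
       in
       if verts G' = {} then Some Z
       else
         let p = Max (\<alpha> ` verts G');
             i = player_of p;
             U = {v \<in> verts G'. \<alpha> v = p};
             H = remove G' (Attr G' i U)
         in do {
           W' \<leftarrow> ziel_psolver PSolver H (restrict \<alpha> (verts H));
           if W' (opponent i) = {} then
             Some (Z(i := Z i \<union> W' i \<union> Attr G' i U))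
           else
             let X = Attr G' (opponent i) (W' (opponent i));
                 K = remove G' X
             in do {
               W'' \<leftarrow> ziel_psolver PSolver K (restrict \<alpha> (verts K));
               Some (Z(i := Z i \<union> W'' i,
                       opponent i := Z (opponent i) \<union> W'' (opponent i) \<union> X))
             }
         })"

end

theory Submission imports Defs begin

text \<open>
  All winning sets involved are obtained from one switching principle: for an objective closed
  under prepending finite prefixes, it suffices to reach the winning set instead of winning
  outright. It gives the closure properties of winning sets and attractors, and it shows that a
  winning strategy on a subgame is winning on the whole game whenever the opponent can leave the
  subgame only into vertices that are already won. The hypothesis on the partial solver says
  precisely that this is so for the subgame left by the solver, and attractors provide the same
  property for the two recursive calls. The remaining case, where the opponent wins nowhere in the
  first recursive call, is handled by restarting the strategy after each visit to the maximal
  priority. Thus each returned set is contained in the right winning set; as the returned sets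
  cover all vertices and the winning sets are disjoint, equality follows.
\<close>

section \<open>Players, subgames and restricted priority functions\<close>

lemma opponent_opponent [simp]: "opponent (opponent i) = i"
  by (cases i) auto

lemma opponent_neq [simp]: "opponent i \<noteq> i" "i \<noteq> opponent i"
  by (cases i; simp)+

lemma player_cases_opponent: "j = i \<or> j = opponent i"
  by (cases i; cases j) auto

lemma owned_subset_verts: "owned G i \<subseteq> verts G"
  by (cases i) (auto simp: verts_def)

lemma owned_opponentI: "v \<in> verts G \<Longrightarrow> v \<notin> owned G i \<Longrightarrow> v \<in> owned G (opponent i)"
  by (cases i) (auto simp: verts_def)

lemma owned_opponentD:
  "game_structure G \<Longrightarrow> v \<in> owned G (opponent i) \<Longrightarrow> v \<notin> owned G i"
  by (cases i) (auto simp: game_structure_def)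

lemma game_structure_edgeD:
  "game_structure G \<Longrightarrow> (v, v') \<in> edges G \<Longrightarrow> v \<in> verts G \<and> v' \<in> verts G"
  by (auto simp: game_structure_def)

lemma verts_restriction: "verts (restriction G U) = verts G \<inter> U"
  by (auto simp: verts_def restriction_def)

lemma owned_restriction: "owned (restriction G U) i = owned G i \<inter> U"
  by (simp add: restriction_def)

lemma edges_restriction: "edges (restriction G U) = edges G \<inter> (U \<times> U)"
  by (simp add: restriction_def)

lemma verts_remove: "verts (remove G X) = verts G - X"
  by (auto simp: remove_def verts_restriction)

lemma game_structure_restriction:
  assumes "game_structure G" "subgame_structure G U"
  shows "game_structure (restriction G U)"
  using assms unfolding game_structure_def subgame_structure_def
  by (auto simp: verts_restriction owned_restriction edges_restriction)

lemma parity_game_restrict: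
  assumes "game_structure H" "verts H \<subseteq> verts G" "parity_game G \<alpha>"
  shows "parity_game H (restrict \<alpha> (verts H))"
proof -
  obtain d where "\<alpha> \<in> verts G \<rightarrow>\<^sub>E {0..d}"
    using assms(3) by (auto simp: parity_game_def)
  then have "restrict \<alpha> (verts H) \<in> verts H \<rightarrow>\<^sub>E {0..d}"
    using assms(2) by (auto simp: PiE_def)
  then show ?thesis using assms(1) by (auto simp: parity_game_def)
qed


section \<open>Histories and suffixes of plays\<close>

lemma play_verts: "play G \<pi> \<Longrightarrow> \<pi> n \<in> verts G"
  by (simp add: play_def)

lemma play_edges: "play G \<pi> \<Longrightarrow> (\<pi> n, \<pi> (Suc n)) \<in> edges G"
  by (simp add: play_def)

lemma play_suffix: "play G \<pi> \<Longrightarrow> play G (\<lambda>m. \<pi> (n + m))"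
  by (simp add: play_def)

lemma play_restriction: "play (restriction G U) \<pi> \<longleftrightarrow> play G \<pi> \<and> (\<forall>n. \<pi> n \<in> U)"
  by (auto simp: play_def verts_restriction edges_restriction)

lemma history_restriction: "history (restriction G U) h \<longleftrightarrow> history G h \<and> set h \<subseteq> U"
proof -
  have "(h ! n, h ! Suc n) \<in> U \<times> U" if "set h \<subseteq> U" "Suc n < length h" for n
    using that nth_mem[of n h] nth_mem[of "Suc n" h] by auto
  then show ?thesis
    by (auto simp: history_def verts_restriction edges_restriction)
qed

lemma history_suffix: "history G (xs @ ys) \<Longrightarrow> ys \<noteq> [] \<Longrightarrow> history G ys"
  unfolding history_def
proof (intro conjI allI impI)
  fix n
  assume h: "xs @ ys \<noteq> [] \<and> set (xs @ ys) \<subseteq> verts G \<and>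
    (\<forall>n. Suc n < length (xs @ ys) \<longrightarrow> ((xs @ ys) ! n, (xs @ ys) ! Suc n) \<in> edges G)"
    and "Suc n < length ys"
  then show "(ys ! n, ys ! Suc n) \<in> edges G"
    using h[THEN conjunct2, THEN conjunct2, rule_format, of "length xs + n"]
    by (simp add: nth_append)
qed auto

lemma history_map_play:
  assumes "play G \<pi>" shows "history G (map \<pi> [0..<Suc n])"
proof -
  have "(map \<pi> [0..<Suc n] ! k, map \<pi> [0..<Suc n] ! Suc k) \<in> edges G"
    if "Suc k < length (map \<pi> [0..<Suc n])" for k
  proof -
    from that have "k < n" by simp
    then show ?thesis using play_edges[OF assms, of k] by (simp del: upt_Suc)
  qed
  then show ?thesis
    using play_verts[OF assms] by (auto simp: history_def simp del: upt_Suc)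
qed

text \<open>Splits the history of a play at a switching time \<open>n\<close>. The right part is the
  history of the suffix play, which is what a strategy restarted at \<open>n\<close> gets to
  see.\<close>

lemma map_upt_split:
  "n \<le> m \<Longrightarrow> map \<pi> [0..<m] = map \<pi> [0..<n] @ map (\<lambda>k. \<pi> (n + k)) [0..<m - n]"
  by (rule nth_equalityI) (auto simp: nth_append)

text \<open>Default move: \<open>strategy\<close> demands a legal edge after every history ending in
  an own vertex, including those on which the constructions below have nothing to choose.\<close>

definition successor :: "'v game \<Rightarrow> 'v \<Rightarrow> 'v" where
  "successor G v = (SOME v'. (v, v') \<in> edges G)"

lemma successor_edge: "game_structure G \<Longrightarrow> v \<in> verts G \<Longrightarrow> (v, successor G v) \<in> edges G"
  unfolding successor_def by (rule someI_ex) (auto simp: game_structure_def)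


section \<open>Winning sets\<close>

lemma WinI:
  assumes "v \<in> verts G" "strategy G i \<sigma>"
    and "\<And>\<pi>. play G \<pi> \<Longrightarrow> \<pi> 0 = v \<Longrightarrow> consistent G i \<sigma> \<pi> \<Longrightarrow> \<pi> \<in> \<Omega>"
  shows "v \<in> Win G i \<Omega>"
  using assms by (auto simp: Win_def)

lemma Win_subset_verts: "Win G i \<Omega> \<subseteq> verts G"
  by (auto simp: Win_def)

lemma Win_mono: "\<Omega> \<subseteq> \<Omega>' \<Longrightarrow> Win G i \<Omega> \<subseteq> Win G i \<Omega>'"
  unfolding Win_def by blast

text \<open>Choice of one strategy per winning start vertex. The composite strategies below select
  \<open>s v\<close> by the vertex \<open>v\<close> at which they restart.\<close>

lemma Win_strategies:
  obtains s where
    "\<And>v. v \<in> Win G i \<Omega> \<Longrightarrow> strategy G i (s v)"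
    "\<And>v \<pi>. v \<in> Win G i \<Omega> \<Longrightarrow> play G \<pi> \<Longrightarrow> \<pi> 0 = v \<Longrightarrow> consistent G i (s v) \<pi> \<Longrightarrow> \<pi> \<in> \<Omega>"
proof -
  have "\<forall>v\<in>Win G i \<Omega>. \<exists>\<sigma>. strategy G i \<sigma> \<and>
      (\<forall>\<pi>. play G \<pi> \<and> \<pi> 0 = v \<and> consistent G i \<sigma> \<pi> \<longrightarrow> \<pi> \<in> \<Omega>)"
    by (auto simp: Win_def)
  then obtain s where "\<forall>v\<in>Win G i \<Omega>. strategy G i (s v) \<and>
      (\<forall>\<pi>. play G \<pi> \<and> \<pi> 0 = v \<and> consistent G i (s v) \<pi> \<longrightarrow> \<pi> \<in> \<Omega>)"
    by (auto dest: bchoice)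
  then show ?thesis by (intro that[of s]) auto
qed

text \<open>One half of prefix independence, from a suffix to the whole play. Parity objectives are
  stable in both directions, reachability objectives in general only in this one.\<close>

definition prepend_closed :: "'v game \<Rightarrow> (nat \<Rightarrow> 'v) set \<Rightarrow> bool" where
  "prepend_closed G \<Omega> \<longleftrightarrow> (\<forall>\<pi> n. play G \<pi> \<and> (\<lambda>m. \<pi> (n + m)) \<in> \<Omega> \<longrightarrow> \<pi> \<in> \<Omega>)"

lemma prepend_closedD:
  "prepend_closed G \<Omega> \<Longrightarrow> play G \<pi> \<Longrightarrow> (\<lambda>m. \<pi> (n + m)) \<in> \<Omega> \<Longrightarrow> \<pi> \<in> \<Omega>"
  by (auto simp: prepend_closed_def)

lemma prepend_closed_Reach: "prepend_closed G (Reach G U)"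
  by (auto simp: prepend_closed_def Reach_def)

lemma prepend_closed_Un:
  "prepend_closed G A \<Longrightarrow> prepend_closed G B \<Longrightarrow> prepend_closed G (A \<union> B)"
  unfolding prepend_closed_def by blast

text \<open>A play that never meets the winning set is consistent with \<sigma>, hence lies in
  \<Omega>. Otherwise its suffix from the first visit is consistent with a winning strategy, and
  \<Omega> absorbs the prefix.\<close>

lemma Win_reach_Win:
  assumes pc: "prepend_closed G \<Omega>"
  shows "Win G i (\<Omega> \<union> Reach G (Win G i \<Omega>)) \<subseteq> Win G i \<Omega>"
proof
  let ?W = "Win G i \<Omega>"
  fix v assume "v \<in> Win G i (\<Omega> \<union> Reach G ?W)"
  then obtain \<sigma> where v: "v \<in> verts G" and \<sigma>: "strategy G i \<sigma>"
    and \<sigma>w: "\<And>\<pi>. play G \<pi> \<Longrightarrow> \<pi> 0 = v \<Longrightarrow> consistent G i \<sigma> \<pi> \<Longrightarrow> \<pi> \<in> \<Omega> \<union> Reach G ?W"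
    by (auto simp: Win_def)
  obtain s where s: "\<And>v. v \<in> ?W \<Longrightarrow> strategy G i (s v)"
    and sw: "\<And>v \<pi>. v \<in> ?W \<Longrightarrow> play G \<pi> \<Longrightarrow> \<pi> 0 = v \<Longrightarrow> consistent G i (s v) \<pi> \<Longrightarrow> \<pi> \<in> \<Omega>"
    using Win_strategies[of G i \<Omega>] by blast
  \<comment> \<open>Switch to the winning strategy at the first visit to the winning set.\<close>
  define \<tau> where "\<tau> h = (let t = dropWhile (\<lambda>x. x \<notin> ?W) h in
      if t = [] then \<sigma> h else s (hd t) t)" for h
  show "v \<in> ?W"
  proof (rule WinI[OF v, of i \<tau>])
    show "strategy G i \<tau>"
      unfolding strategy_def
    proof (intro allI impI, elim conjE)
      fix h assume h: "history G h" "last h \<in> owned G i"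
      let ?t = "dropWhile (\<lambda>x. x \<notin> ?W) h"
      show "(last h, \<tau> h) \<in> edges G"
      proof (cases "?t = []")
        case True
        then show ?thesis using \<sigma> h by (simp add: \<tau>_def strategy_def)
      next
        case False
        have e: "h = takeWhile (\<lambda>x. x \<notin> ?W) h @ ?t" by simp
        have ht: "history G ?t" using history_suffix e False h(1) by metis
        have l: "last ?t = last h" using e False by (metis last_appendR)
        have "hd ?t \<in> ?W" using hd_dropWhile[OF False] by simp
        then show ?thesis using s[of "hd ?t"] ht l h(2) False
          by (auto simp: \<tau>_def strategy_def Let_def)
      qed
    qed
  next
    fix \<pi> assume p: "play G \<pi>" and p0: "\<pi> 0 = v" and c: "consistent G i \<tau> \<pi>"
    show "\<pi> \<in> \<Omega>"
    proof (cases "\<exists>n. \<pi> n \<in> ?W")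
      case False
      have "dropWhile (\<lambda>x. x \<notin> ?W) (map \<pi> [0..<Suc n]) = []" for n
        using False by (auto simp: dropWhile_eq_Nil_conv simp del: upt_Suc)
      then have "consistent G i \<sigma> \<pi>"
        using c by (simp add: consistent_def \<tau>_def del: upt_Suc)
      then show ?thesis using \<sigma>w[OF p p0] False by (auto simp: Reach_def)
    next
      case True
      define n where "n = (LEAST n. \<pi> n \<in> ?W)"
      have nW: "\<pi> n \<in> ?W" unfolding n_def using True by (rule LeastI_ex)
      have less: "\<pi> k \<notin> ?W" if "k < n" for k
        using that unfolding n_def by (rule not_less_Least)
      let ?\<rho> = "\<lambda>m. \<pi> (n + m)"
      \<comment> \<open>At every time from \<open>n\<close> on, \<open>dropWhile\<close> cuts off
        exactly the first \<open>n\<close> vertices, so \<tau> hands to \<open>s\<close> the history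
        of the suffix play.\<close>
      have dw: "dropWhile (\<lambda>x. x \<notin> ?W) (map \<pi> [0..<Suc (n + m)]) = map ?\<rho> [0..<Suc m]" for m
      proof -
        have "map \<pi> [0..<Suc (n + m)] = map \<pi> [0..<n] @ map ?\<rho> [0..<Suc m]"
          using map_upt_split[of n "Suc (n + m)" \<pi>]
          by (simp del: upt_Suc add: Suc_diff_le)
        moreover have "map ?\<rho> [0..<Suc m] = \<pi> n # map ?\<rho> [1..<Suc m]"
          by (simp add: upt_conv_Cons del: upt_Suc)
        moreover have "dropWhile (\<lambda>x. x \<notin> ?W) (map \<pi> [0..<n] @ ys) = dropWhile (\<lambda>x. x \<notin> ?W) ys" for ys
          by (rule dropWhile_append2) (use less in auto)
        ultimately show ?thesis using nW by (simp del: upt_Suc)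
      qed
      have "consistent G i (s (\<pi> n)) ?\<rho>"
        unfolding consistent_def
      proof (intro allI impI)
        fix m assume "?\<rho> m \<in> owned G i"
        then have "\<pi> (Suc (n + m)) = \<tau> (map \<pi> [0..<Suc (n + m)])"
          using c by (auto simp: consistent_def simp del: upt_Suc)
        also have "\<dots> = s (\<pi> n) (map ?\<rho> [0..<Suc m])"
          by (simp add: \<tau>_def dw hd_map del: upt_Suc)
        finally show "?\<rho> (Suc m) = s (\<pi> n) (map ?\<rho> [0..<Suc m])" by (simp del: upt_Suc)
      qed
      then have "?\<rho> \<in> \<Omega>" using sw[OF nW play_suffix[OF p]] by simp
      then show ?thesis using prepend_closedD[OF pc p] by blast
    qed
  qed
qed

text \<open>Moving to \<open>v'\<close> whenever the play is at \<open>v\<close> reaches the winning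
  set in one step, so the switching lemma applies.\<close>

lemma Win_step_own:
  assumes G: "game_structure G" and pc: "prepend_closed G \<Omega>"
    and v: "v \<in> owned G i" "(v, v') \<in> edges G" "v' \<in> Win G i \<Omega>"
  shows "v \<in> Win G i \<Omega>"
proof -
  have "v \<in> Win G i (\<Omega> \<union> Reach G (Win G i \<Omega>))"
  proof (rule WinI[where \<sigma> = "\<lambda>h. if last h = v then v' else successor G (last h)"])
    show "v \<in> verts G" using v(1) owned_subset_verts[of G i] by blast
    show "strategy G i (\<lambda>h. if last h = v then v' else successor G (last h))"
      using v owned_subset_verts successor_edge[OF G] by (fastforce simp: strategy_def)
  next
    fix \<pi> assume "play G \<pi>" "\<pi> 0 = v"
      and c: "consistent G i (\<lambda>h. if last h = v then v' else successor G (last h)) \<pi>"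
    moreover from this have "\<pi> (Suc 0) = v'"
      using v(1) c[unfolded consistent_def, rule_format, of 0] by simp
    ultimately show "\<pi> \<in> \<Omega> \<union> Reach G (Win G i \<Omega>)"
      using v(3) by (auto simp: Reach_def)
  qed
  then show ?thesis using Win_reach_Win[OF pc] by blast
qed

lemma Win_step_opponent:
  assumes G: "game_structure G" and pc: "prepend_closed G \<Omega>"
    and v: "v \<in> verts G" "\<And>v'. (v, v') \<in> edges G \<Longrightarrow> v' \<in> Win G i \<Omega>"
  shows "v \<in> Win G i \<Omega>"
proof -
  have "v \<in> Win G i (\<Omega> \<union> Reach G (Win G i \<Omega>))"
  proof (rule WinI[OF v(1), where \<sigma> = "\<lambda>h. successor G (last h)"])
    show "strategy G i (\<lambda>h. successor G (last h))"
      using owned_subset_verts successor_edge[OF G] by (fastforce simp: strategy_def)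
  next
    fix \<pi> assume "play G \<pi>" "\<pi> 0 = v"
    then show "\<pi> \<in> \<Omega> \<union> Reach G (Win G i \<Omega>)"
      using v(2) play_edges[of G \<pi> 0] by (auto simp: Reach_def)
  qed
  then show ?thesis using Win_reach_Win[OF pc] by blast
qed

text \<open>A vertex whose successors all lie in the winning set would itself be winning. With a
  reachability objective this shows that removing an attractor leaves a game structure.\<close>

lemma subgame_structure_minus_Win:
  assumes G: "game_structure G" and pc: "prepend_closed G \<Omega>"
  shows "subgame_structure G (verts G - Win G i \<Omega>)"
  unfolding subgame_structure_def
proof (intro conjI ballI)
  fix v assume "v \<in> verts (restriction G (verts G - Win G i \<Omega>))"
  then have v: "v \<in> verts G" "v \<notin> Win G i \<Omega>" by (auto simp: verts_restriction)
  then obtain v' where v': "(v, v') \<in> edges G" "v' \<notin> Win G i \<Omega>"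
    using Win_step_opponent[OF G pc] by blast
  then show "\<exists>v'. (v, v') \<in> edges (restriction G (verts G - Win G i \<Omega>))"
    using v game_structure_edgeD[OF G v'(1)] by (auto simp: edges_restriction)
qed auto

text \<open>While the play stays in \<open>U\<close>, a strategy of the subgame keeps all moves of
  player \<open>i\<close> inside \<open>U\<close>. So only the opponent can leave \<open>U\<close>,
  and then the play enters a vertex that is already won.\<close>

lemma Win_restriction_subset:
  assumes G: "game_structure G" and pc: "prepend_closed G \<Omega>" and sub: "\<Omega>' \<subseteq> \<Omega>"
    and esc: "\<And>v v'. v \<in> owned G (opponent i) \<Longrightarrow> v \<in> U \<Longrightarrow> (v, v') \<in> edges G \<Longrightarrow> v' \<notin> U
      \<Longrightarrow> v' \<in> Win G i \<Omega>"
  shows "Win (restriction G U) i \<Omega>' \<subseteq> Win G i \<Omega>"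
proof
  fix v assume "v \<in> Win (restriction G U) i \<Omega>'"
  then obtain \<sigma> where v: "v \<in> verts G" "v \<in> U" and \<sigma>: "strategy (restriction G U) i \<sigma>"
    and \<sigma>w: "\<And>\<pi>. play (restriction G U) \<pi> \<Longrightarrow> \<pi> 0 = v \<Longrightarrow>
      consistent (restriction G U) i \<sigma> \<pi> \<Longrightarrow> \<pi> \<in> \<Omega>'"
    by (auto simp: Win_def verts_restriction)
  \<comment> \<open>The test concerns the whole history: a history inside \<open>U\<close> is one of
    the subgame, so \<sigma> moves legally there. After an exit only legality matters.\<close>
  define \<tau> where "\<tau> h = (if set h \<subseteq> U then \<sigma> h else successor G (last h))" for h
  have inU: "(last h, \<sigma> h) \<in> edges G \<inter> (U \<times> U)"
    if "history G h" "last h \<in> owned G i" "set h \<subseteq> U" for h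
  proof -
    have "last h \<in> U" using that by (auto simp: history_def)
    then show ?thesis using \<sigma> that
      by (auto simp: strategy_def history_restriction owned_restriction edges_restriction)
  qed
  have "v \<in> Win G i (\<Omega> \<union> Reach G (Win G i \<Omega>))"
  proof (rule WinI[OF v(1), where \<sigma> = \<tau>])
    show "strategy G i \<tau>"
      using inU owned_subset_verts successor_edge[OF G]
      by (fastforce simp: strategy_def \<tau>_def)
  next
    fix \<pi> assume p: "play G \<pi>" and p0: "\<pi> 0 = v" and c: "consistent G i \<tau> \<pi>"
    show "\<pi> \<in> \<Omega> \<union> Reach G (Win G i \<Omega>)"
    proof (cases "\<forall>n. \<pi> n \<in> U")
      case True
      then have "play (restriction G U) \<pi>" using p by (simp add: play_restriction)
      moreover have "consistent (restriction G U) i \<sigma> \<pi>"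
        using c True unfolding consistent_def \<tau>_def
        by (auto simp: owned_restriction image_subset_iff simp del: upt_Suc)
      ultimately show ?thesis using \<sigma>w p0 sub by blast
    next
      case False
      then have ex: "\<exists>n. \<pi> n \<notin> U" by simp
      define n where "n = (LEAST n. \<pi> n \<notin> U)"
      have nU: "\<pi> n \<notin> U" unfolding n_def using ex by (rule LeastI_ex)
      have less: "\<pi> k \<in> U" if "k < n" for k
        using that not_less_Least unfolding n_def by blast
      \<comment> \<open>\<open>n\<close> is positive because the play starts in \<open>U\<close>. Up
        to \<open>m\<close>, the last position before the exit, \<tau> agrees with \<sigma>.\<close>
      obtain m where m: "n = Suc m" using nU p0 v(2) by (cases n) auto
      have hU: "set (map \<pi> [0..<Suc m]) \<subseteq> U" using less m by (auto simp del: upt_Suc)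
      have "\<pi> m \<notin> owned G i"
      proof
        assume o: "\<pi> m \<in> owned G i"
        then have "\<pi> n = \<sigma> (map \<pi> [0..<Suc m])"
          using c hU m by (simp add: consistent_def \<tau>_def del: upt_Suc set_map)
        moreover have "last (map \<pi> [0..<Suc m]) = \<pi> m" by simp
        ultimately show False
          using inU[OF history_map_play[OF p, of m] _ hU] o nU by (simp del: upt_Suc)
      qed
      then have "\<pi> n \<in> Win G i \<Omega>"
        using esc[of "\<pi> m" "\<pi> n"] owned_opponentI[OF play_verts[OF p]] less m nU play_edges[OF p]
        by simp
      then show ?thesis using p by (auto simp: Reach_def)
    qed
  qed
  then show "v \<in> Win G i \<Omega>" using Win_reach_Win[OF pc] by blast
qed

text \<open>Restart after every visit to \<open>U\<close>, which is possible because every vertex is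
  winning for the combined objective. With finitely many visits, the suffix after the last one
  follows a single strategy and avoids \<open>U\<close>, so it lies in \<Omega>.\<close>

lemma Win_recurrence:
  assumes G: "game_structure G" and pc: "prepend_closed G \<Omega>"
    and all: "verts G \<subseteq> Win G i (\<Omega> \<union> Reach G U)"
  shows "verts G \<subseteq> Win G i (\<Omega> \<union> {\<pi>. play G \<pi> \<and> (\<exists>\<^sub>\<infinity>n. \<pi> n \<in> U)})"
proof
  obtain s where s: "\<And>v. v \<in> verts G \<Longrightarrow> strategy G i (s v)"
    and sw: "\<And>v \<pi>. v \<in> verts G \<Longrightarrow> play G \<pi> \<Longrightarrow> \<pi> 0 = v \<Longrightarrow> consistent G i (s v) \<pi> \<Longrightarrow>
      \<pi> \<in> \<Omega> \<union> Reach G U"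
  proof (rule Win_strategies[of G i "\<Omega> \<union> Reach G U"])
    fix s
    assume "\<And>v. v \<in> Win G i (\<Omega> \<union> Reach G U) \<Longrightarrow> strategy G i (s v)"
      "\<And>v \<pi>. v \<in> Win G i (\<Omega> \<union> Reach G U) \<Longrightarrow> play G \<pi> \<Longrightarrow> \<pi> 0 = v \<Longrightarrow>
        consistent G i (s v) \<pi> \<Longrightarrow> \<pi> \<in> \<Omega> \<union> Reach G U"
    then show thesis using that[of s] all by (meson subsetD)
  qed
  \<comment> \<open>The part of the history after the last visit to \<open>U\<close>.\<close>
  define t where "t h = rev (takeWhile (\<lambda>x. x \<notin> U) (rev h))" for h
  \<comment> \<open>\<open>t h = []\<close> means that \<open>h\<close> ends in \<open>U\<close> (or
    is empty). Any legal move will do there; the strategy restarts at the vertex entered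
    next.\<close>
  define \<tau> where "\<tau> h = (if t h = [] then successor G (last h) else s (hd (t h)) (t h))" for h
  have t_split: "\<exists>xs. h = xs @ t h" for h
  proof -
    have "rev h = takeWhile (\<lambda>x. x \<notin> U) (rev h) @ dropWhile (\<lambda>x. x \<notin> U) (rev h)" by simp
    then have "rev (rev h) = rev (dropWhile (\<lambda>x. x \<notin> U) (rev h)) @ t h"
      unfolding t_def by (metis rev_append)
    then show ?thesis by auto
  qed
  fix v assume v: "v \<in> verts G"
  show "v \<in> Win G i (\<Omega> \<union> {\<pi>. play G \<pi> \<and> (\<exists>\<^sub>\<infinity>n. \<pi> n \<in> U)})"
  proof (rule WinI[OF v, where \<sigma> = \<tau>])
    show "strategy G i \<tau>"
      unfolding strategy_def
    proof (intro allI impI, elim conjE)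
      fix h assume h: "history G h" "last h \<in> owned G i"
      show "(last h, \<tau> h) \<in> edges G"
      proof (cases "t h = []")
        case True
        then show ?thesis
          using h(2) owned_subset_verts successor_edge[OF G] by (fastforce simp: \<tau>_def)
      next
        case False
        obtain xs where e: "h = xs @ t h" using t_split by blast
        have ht: "history G (t h)" using history_suffix e False h(1) by metis
        have l: "last (t h) = last h" using e False by (metis last_appendR)
        have "hd (t h) \<in> verts G" using ht by (auto simp: history_def)
        then show ?thesis using s[of "hd (t h)"] ht l h(2) False
          by (auto simp: \<tau>_def strategy_def)
      qed
    qed
  next
    fix \<pi> assume p: "play G \<pi>" and c: "consistent G i \<tau> \<pi>"
    show "\<pi> \<in> \<Omega> \<union> {\<pi>. play G \<pi> \<and> (\<exists>\<^sub>\<infinity>n. \<pi> n \<in> U)}"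
    proof (cases "\<exists>\<^sub>\<infinity>n. \<pi> n \<in> U")
      case True
      then show ?thesis using p by simp
    next
      case False
      then have ex: "\<exists>n. \<forall>k\<ge>n. \<pi> k \<notin> U"
        by (auto simp: INFM_nat_le)
      define n where "n = (LEAST n. \<forall>k\<ge>n. \<pi> k \<notin> U)"
      have n: "\<pi> k \<notin> U" if "k \<ge> n" for k
        using LeastI_ex[OF ex, folded n_def] that by blast
      \<comment> \<open>By minimality of \<open>n\<close>, the position just before it, if there is
        one, is a visit to \<open>U\<close>. This makes \<open>t\<close> cut later histories exactly
        at \<open>n\<close>; for \<open>n = 0\<close> nothing is cut.\<close>
      have last_visit: "\<pi> m \<in> U" if "n = Suc m" for m
      proof (rule ccontr)
        assume m: "\<pi> m \<notin> U"
        have "\<forall>k\<ge>m. \<pi> k \<notin> U"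
        proof (intro allI impI)
          fix k assume "m \<le> k"
          then show "\<pi> k \<notin> U" using m n[of k] that by (cases "k = m") auto
        qed
        then have "n \<le> m" unfolding n_def by (rule Least_le)
        then show False using that by simp
      qed
      let ?\<rho> = "\<lambda>m. \<pi> (n + m)"
      have tm: "t (map \<pi> [0..<Suc (n + m)]) = map ?\<rho> [0..<Suc m]" for m
      proof -
        have sp: "map \<pi> [0..<Suc (n + m)] = map \<pi> [0..<n] @ map ?\<rho> [0..<Suc m]"
          using map_upt_split[of n "Suc (n + m)" \<pi>]
          by (simp del: upt_Suc add: Suc_diff_le)
        have tw: "takeWhile (\<lambda>x. x \<notin> U) (rev (map \<pi> [0..<n])) = []"
        proof (cases n)
          case (Suc k)
          then show ?thesis using last_visit by simp
        qed simp
        have "\<forall>x\<in>set (rev (map ?\<rho> [0..<Suc m])). x \<notin> U" using n by (auto simp del: upt_Suc)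
        then have "takeWhile (\<lambda>x. x \<notin> U) (rev (map ?\<rho> [0..<Suc m]) @ rev (map \<pi> [0..<n]))
          = rev (map ?\<rho> [0..<Suc m])"
          using tw by (subst takeWhile_append2) (auto simp del: upt_Suc)
        then show ?thesis unfolding t_def sp by (simp del: upt_Suc)
      qed
      have "consistent G i (s (\<pi> n)) ?\<rho>"
        unfolding consistent_def
      proof (intro allI impI)
        fix m assume "?\<rho> m \<in> owned G i"
        then have "\<pi> (Suc (n + m)) = \<tau> (map \<pi> [0..<Suc (n + m)])"
          using c by (auto simp: consistent_def simp del: upt_Suc)
        also have "\<dots> = s (\<pi> n) (map ?\<rho> [0..<Suc m])"
          by (simp add: \<tau>_def tm hd_map del: upt_Suc)
        finally show "?\<rho> (Suc m) = s (\<pi> n) (map ?\<rho> [0..<Suc m])" by (simp del: upt_Suc)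
      qed
      then have "?\<rho> \<in> \<Omega> \<union> Reach G U"
        using sw[OF play_verts[OF p] play_suffix[OF p]] by simp
      moreover have "?\<rho> \<notin> Reach G U" using n by (auto simp: Reach_def)
      ultimately show ?thesis using prepend_closedD[OF pc p] by blast
    qed
  qed
qed

text \<open>Two winning strategies from a common vertex, played against each other, produce a play
  that lies in both objectives.\<close>

lemma Win_opponent_disjoint:
  assumes G: "game_structure G" and dis: "\<Omega>0 \<inter> \<Omega>1 = {}"
  shows "Win G P0 \<Omega>0 \<inter> Win G P1 \<Omega>1 = {}"
proof (rule ccontr)
  assume "Win G P0 \<Omega>0 \<inter> Win G P1 \<Omega>1 \<noteq> {}"
  then obtain v \<sigma>0 \<sigma>1 where v: "v \<in> verts G"
    and s: "strategy G P0 \<sigma>0" "strategy G P1 \<sigma>1"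
    and w0: "\<And>\<pi>. play G \<pi> \<Longrightarrow> \<pi> 0 = v \<Longrightarrow> consistent G P0 \<sigma>0 \<pi> \<Longrightarrow> \<pi> \<in> \<Omega>0"
    and w1: "\<And>\<pi>. play G \<pi> \<Longrightarrow> \<pi> 0 = v \<Longrightarrow> consistent G P1 \<sigma>1 \<pi> \<Longrightarrow> \<pi> \<in> \<Omega>1"
    unfolding Win_def by blast
  define nxt where "nxt h = (if last h \<in> owned G P0 then \<sigma>0 h else \<sigma>1 h)" for h
  \<comment> \<open>The recursion builds whole histories, since both strategies read the entire
    past; the play consists of their last vertices.\<close>
  define hist where "hist = rec_nat [v] (\<lambda>_ h. h @ [nxt h])"
  have h0: "hist 0 = [v]" and hS: "hist (Suc n) = hist n @ [nxt (hist n)]" for n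
    by (simp_all add: hist_def)
  define \<pi> where "\<pi> n = last (hist n)" for n
  have \<pi>S: "\<pi> (Suc n) = nxt (hist n)" for n by (simp add: \<pi>_def hS)
  have hm: "map \<pi> [0..<Suc n] = hist n" for n
    by (induction n) (auto simp: h0 hS \<pi>_def)
  have nxt_edge: "(last h, nxt h) \<in> edges G" if "history G h" for h
  proof -
    have "last h \<in> verts G" using that by (auto simp: history_def)
    then show ?thesis using s that by (auto simp: nxt_def strategy_def verts_def)
  qed
  have hh: "history G (hist n)" for n
  proof (induction n)
    case 0
    then show ?case using v by (simp add: h0 history_def)
  next
    case (Suc n)
    note e = nxt_edge[OF Suc]
    show ?case
      unfolding history_def
    proof (intro conjI allI impI)
      show "set (hist (Suc n)) \<subseteq> verts G"
        using Suc game_structure_edgeD[OF G e] by (auto simp: hS history_def)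
      fix k assume k: "Suc k < length (hist (Suc n))"
      show "(hist (Suc n) ! k, hist (Suc n) ! Suc k) \<in> edges G"
      proof (cases "Suc k < length (hist n)")
        case True
        then show ?thesis using Suc by (simp add: hS history_def nth_append)
      next
        case False
        then have "length (hist n) = Suc k" using k by (simp add: hS)
        moreover from this have "hist n ! k = last (hist n)"
          by (metis Suc_neq_Zero diff_Suc_1 last_conv_nth length_0_conv)
        ultimately show ?thesis using e by (simp add: hS nth_append)
      qed
    qed (simp add: hS)
  qed
  have p: "play G \<pi>"
    unfolding play_def
  proof
    fix n
    have "(\<pi> n, \<pi> (Suc n)) \<in> edges G"
      unfolding \<pi>S using nxt_edge[OF hh] by (simp add: \<pi>_def)
    then show "\<pi> n \<in> verts G \<and> (\<pi> n, \<pi> (Suc n)) \<in> edges G"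
      using game_structure_edgeD[OF G] by blast
  qed
  have "consistent G P0 \<sigma>0 \<pi>" "consistent G P1 \<sigma>1 \<pi>"
    using owned_opponentD[OF G, of _ P0]
    by (auto simp: consistent_def hm \<pi>S nxt_def \<pi>_def[symmetric] simp del: upt_Suc)
  moreover have "\<pi> 0 = v" by (simp add: \<pi>_def h0)
  ultimately show False using w0[OF p] w1[OF p] dis by blast
qed


section \<open>Attractors\<close>

lemma subset_Attr:
  assumes "game_structure G" "U \<subseteq> verts G"
  shows "U \<subseteq> Attr G i U"
proof
  fix v assume v: "v \<in> U"
  show "v \<in> Attr G i U"
    unfolding Attr_def
  proof (rule WinI[where \<sigma> = "\<lambda>h. successor G (last h)"])
    show "v \<in> verts G" using v assms by blast
    show "strategy G i (\<lambda>h. successor G (last h))"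
      using owned_subset_verts successor_edge[OF assms(1)] by (fastforce simp: strategy_def)
  qed (use v in \<open>auto simp: Reach_def\<close>)
qed

lemma game_structure_remove_Attr:
  "game_structure G \<Longrightarrow> game_structure (remove G (Attr G i U))"
  unfolding remove_def Attr_def
  by (intro game_structure_restriction subgame_structure_minus_Win prepend_closed_Reach)

text \<open>Hence the complement of the attractor is a trap for player \<open>i\<close>: no move of
  that player leaves it.\<close>

lemma Attr_edgeD:
  assumes "game_structure G" "v \<in> owned G i" "(v, v') \<in> edges G" "v' \<in> Attr G i U"
  shows "v \<in> Attr G i U"
  using Win_step_own[OF assms(1) prepend_closed_Reach assms(2,3)] assms(4)
  by (simp add: Attr_def)

text \<open>Forcing a visit to \<open>A\<close> forces a visit to the winning set, where the
  switching lemma takes over.\<close>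

lemma Attr_Win_subset:
  assumes "prepend_closed G \<Omega>" "A \<subseteq> Win G i \<Omega>"
  shows "Attr G i A \<subseteq> Win G i \<Omega>"
proof -
  have "Reach G A \<subseteq> \<Omega> \<union> Reach G (Win G i \<Omega>)"
    using assms(2) by (auto simp: Reach_def)
  then show ?thesis
    using Win_mono Win_reach_Win[OF assms(1)] unfolding Attr_def by blast
qed


section \<open>Parity objectives\<close>

lemma Parity_iff:
  "\<pi> \<in> Parity i G \<alpha> \<longleftrightarrow> play G \<pi> \<and> player_of (max_inf_priority \<alpha> \<pi>) = i"
  by (cases i) (auto simp: EvenParity_def OddParity_def player_of_def even_iff_mod_2_eq_zero)

text \<open>Holding infinitely often is invariant under index shifts. This is obtained from the
  negation, an eventual property along the sequential filter.\<close>

lemma max_inf_priority_suffix: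
  "max_inf_priority \<alpha> (\<lambda>m. \<pi> (n + m)) = max_inf_priority \<alpha> \<pi>"
proof -
  have "(\<exists>\<^sub>\<infinity>m. P (n + m)) \<longleftrightarrow> (\<exists>\<^sub>\<infinity>m. P m)" for P :: "nat \<Rightarrow> bool"
    using eventually_sequentially_seg[of "\<lambda>m. \<not> P m" n]
    by (simp add: frequently_def cofinite_eq_sequentially add.commute)
  from this[of "\<lambda>m. \<alpha> (\<pi> m) = _"] show ?thesis
    by (simp add: max_inf_priority_def)
qed

lemma prepend_closed_Parity: "prepend_closed G (Parity i G \<alpha>)"
  by (auto simp: prepend_closed_def Parity_iff max_inf_priority_suffix)

lemma Parity_restriction_subset:
  "Parity i (restriction G U) (restrict \<alpha> (verts (restriction G U))) \<subseteq> Parity i G \<alpha>"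
proof
  fix \<pi> assume a: "\<pi> \<in> Parity i (restriction G U) (restrict \<alpha> (verts (restriction G U)))"
  then have p: "play (restriction G U) \<pi>" by (simp add: Parity_iff)
  have "max_inf_priority (restrict \<alpha> (verts (restriction G U))) \<pi> = max_inf_priority \<alpha> \<pi>"
    using play_verts[OF p] by (simp add: max_inf_priority_def)
  then show "\<pi> \<in> Parity i G \<alpha>" using a p by (simp add: Parity_iff play_restriction)
qed

text \<open>Serves the subgame left by the solver, where the algorithm keeps \<alpha> itself and
  restricts it only for the recursive calls.\<close>

lemma Parity_restriction_subset': "Parity i (restriction G U) \<alpha> \<subseteq> Parity i G \<alpha>"
  by (auto simp: Parity_iff play_restriction)

lemma max_inf_priority_eq:
  assumes "\<And>n. \<alpha> (\<pi> n) \<le> p" "\<exists>\<^sub>\<infinity>n. \<alpha> (\<pi> n) = p"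
  shows "max_inf_priority \<alpha> \<pi> = p"
proof -
  have "{q. \<exists>\<^sub>\<infinity>n. \<alpha> (\<pi> n) = q} \<subseteq> {..p}"
    using assms(1) by (auto dest: INFM_EX)
  then show ?thesis
    unfolding max_inf_priority_def using assms(2)
    by (intro Max_eqI) (auto intro: finite_subset)
qed


section \<open>Correctness of the recursion\<close>

text \<open>On the attractor a visit to \<open>U\<close> can be forced. Elsewhere the strategy of
  \<open>H\<close> wins unless the play escapes into the attractor. So every vertex wins parity or a
  visit to \<open>U\<close>, and recurrence turns the latter into infinitely many visits. These make
  the maximal priority \<open>p\<close> decisive, and its parity favours
  \<open>player_of p\<close>.\<close>

lemma Win_recurse_opponent_empty:
  fixes \<alpha> :: "'v \<Rightarrow> nat"
  assumes G: "game_structure G" and le: "\<And>v. v \<in> verts G \<Longrightarrow> \<alpha> v \<le> p"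
    and U: "U = {v \<in> verts G. \<alpha> v = p}" and H: "H = remove G (Attr G (player_of p) U)"
    and W: "verts H \<subseteq> Win H (player_of p) (Parity (player_of p) H (restrict \<alpha> (verts H)))"
  shows "verts G \<subseteq> Win G (player_of p) (Parity (player_of p) G \<alpha>)"
proof -
  let ?i = "player_of p"
  let ?\<Omega> = "Parity ?i G \<alpha> \<union> Reach G U"
  have pc: "prepend_closed G ?\<Omega>"
    by (intro prepend_closed_Un prepend_closed_Parity prepend_closed_Reach)
  have A: "Attr G ?i U \<subseteq> Win G ?i ?\<Omega>"
    unfolding Attr_def by (rule Win_mono) auto
  have "Win H ?i (Parity ?i H (restrict \<alpha> (verts H))) \<subseteq> Win G ?i ?\<Omega>"
    unfolding H remove_def
  proof (rule Win_restriction_subset[OF G pc])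
    fix v v' assume "(v, v') \<in> edges G" "v' \<notin> verts G - Attr G ?i U"
    then show "v' \<in> Win G ?i ?\<Omega>" using A game_structure_edgeD[OF G] by blast
  qed (use Parity_restriction_subset in blast)
  then have "verts G \<subseteq> Win G ?i ?\<Omega>"
    using A W by (auto simp: H verts_remove)
  from Win_recurrence[OF G prepend_closed_Parity this]
  have "verts G \<subseteq> Win G ?i (Parity ?i G \<alpha> \<union> {\<pi>. play G \<pi> \<and> (\<exists>\<^sub>\<infinity>n. \<pi> n \<in> U)})" .
  moreover have "{\<pi>. play G \<pi> \<and> (\<exists>\<^sub>\<infinity>n. \<pi> n \<in> U)} \<subseteq> Parity ?i G \<alpha>"
  proof clarify
    fix \<pi> assume p: "play G \<pi>" and inf: "\<exists>\<^sub>\<infinity>n. \<pi> n \<in> U"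
    have "\<exists>\<^sub>\<infinity>n. \<alpha> (\<pi> n) = p" using inf by (rule INFM_mono) (simp add: U)
    then have "max_inf_priority \<alpha> \<pi> = p"
      using le play_verts[OF p] by (intro max_inf_priority_eq) auto
    then show "\<pi> \<in> Parity ?i G \<alpha>" using p by (simp add: Parity_iff)
  qed
  ultimately show ?thesis by (simp only: Un_absorb2)
qed

text \<open>Player \<open>i\<close> cannot leave the complement of its own attractor, so a win of
  the opponent there carries over; the escape condition is vacuous.\<close>

lemma Win_remove_Attr_opponent_subset:
  assumes G: "game_structure G" and H: "H = remove G (Attr G i U)"
  shows "Win H (opponent i) (Parity (opponent i) H (restrict \<alpha> (verts H)))
    \<subseteq> Win G (opponent i) (Parity (opponent i) G \<alpha>)"
  unfolding H remove_def
proof (rule Win_restriction_subset[OF G prepend_closed_Parity Parity_restriction_subset])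
  fix v v' assume v: "v \<in> owned G (opponent (opponent i))" "v \<in> verts G - Attr G i U"
    "(v, v') \<in> edges G" "v' \<notin> verts G - Attr G i U"
  then have "v' \<in> Attr G i U" using game_structure_edgeD[OF G] by blast
  then have "v \<in> Attr G i U" using Attr_edgeD[OF G] v by simp
  then show "v' \<in> Win G (opponent i) (Parity (opponent i) G \<alpha>)" using v by blast
qed

text \<open>Here the other player may leave the subgame, but only into the attractor, which is
  assumed to be won.\<close>

lemma Win_remove_Attr_subset:
  assumes G: "game_structure G" and H: "H = remove G (Attr G i U)"
    and A: "Attr G i U \<subseteq> Win G i (Parity i G \<alpha>)"
  shows "Win H i (Parity i H (restrict \<alpha> (verts H))) \<subseteq> Win G i (Parity i G \<alpha>)"
  unfolding H remove_def
proof (rule Win_restriction_subset[OF G prepend_closed_Parity Parity_restriction_subset])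
  fix v v' assume "(v, v') \<in> edges G" "v' \<notin> verts G - Attr G i U"
  then show "v' \<in> Win G i (Parity i G \<alpha>)" using A game_structure_edgeD[OF G] by blast
qed

text \<open>Induction invariant in place of equality: containment and covering can be checked
  separately at each return of the algorithm.\<close>

definition solved :: "'v game \<Rightarrow> ('v \<Rightarrow> nat) \<Rightarrow> (player \<Rightarrow> 'v set) \<Rightarrow> bool" where
  "solved G \<alpha> W \<longleftrightarrow> (\<forall>i. W i \<subseteq> Win G i (Parity i G \<alpha>)) \<and> verts G \<subseteq> W P0 \<union> W P1"

lemma solvedD:
  assumes "solved G \<alpha> W"
  shows "W i \<subseteq> Win G i (Parity i G \<alpha>)" "verts G \<subseteq> W i \<union> W (opponent i)"
proof -
  show "W i \<subseteq> Win G i (Parity i G \<alpha>)" using assms by (simp add: solved_def del: Parity.simps)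
  show "verts G \<subseteq> W i \<union> W (opponent i)"
    using assms by (cases i) (simp_all add: solved_def Un_commute)
qed

text \<open>Phrased for \<open>i\<close> and its opponent because the algorithm chooses its player
  from a priority.\<close>

lemma solvedI:
  assumes "W i \<subseteq> Win G i (Parity i G \<alpha>)"
    and "W (opponent i) \<subseteq> Win G (opponent i) (Parity (opponent i) G \<alpha>)"
    and "verts G \<subseteq> W i \<union> W (opponent i)"
  shows "solved G \<alpha> W"
proof -
  have "W j \<subseteq> Win G j (Parity j G \<alpha>)" for j
    using player_cases_opponent[of j i] assms(1,2) by (elim disjE) simp_all
  moreover have "verts G \<subseteq> W P0 \<union> W P1" using assms(3) by (cases i) (simp_all add: Un_commute)
  ultimately show ?thesis by (simp only: solved_def) simp
qed

lemma solved_eq_Win: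
  assumes G: "game_structure G" and S: "solved G \<alpha> W"
  shows "W i = Win G i (Parity i G \<alpha>)"
proof -
  have "Parity P0 G \<alpha> \<inter> Parity P1 G \<alpha> = {}" by (auto simp: Parity_iff simp del: Parity.simps)
  from Win_opponent_disjoint[OF G this]
  have "Win G i (Parity i G \<alpha>) \<inter> Win G (opponent i) (Parity (opponent i) G \<alpha>) = {}"
    by (cases i) (simp_all add: Int_commute)
  moreover have "Win G i (Parity i G \<alpha>) \<subseteq> W i \<union> W (opponent i)"
    using Win_subset_verts solvedD(2)[OF S] by (rule subset_trans)
  moreover note solvedD(1)[OF S, of i] solvedD(1)[OF S, of "opponent i"]
  ultimately show ?thesis by blast
qed

text \<open>Induction on the number of vertices: both recursive calls remove an attractor of a
  nonempty set. This yields termination together with the invariant.\<close>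

lemma ziel_psolver_solved:
  fixes PSolver :: "'v solver"
  assumes ps: "partial_solver PSolver"
    and esc: "\<And>H \<beta> Vbar v v' i.
           \<lbrakk>parity_game H \<beta>;
            Vbar = verts H - (PSolver H \<beta> P0 \<union> PSolver H \<beta> P1);
            (v, v') \<in> edges H; v \<in> Vbar \<inter> owned H i; v' \<notin> Vbar\<rbrakk>
           \<Longrightarrow> v' \<in> PSolver H \<beta> (opponent i)"
    and "parity_game G \<alpha>"
  shows "\<exists>W. ziel_psolver PSolver G \<alpha> = Some W \<and> solved G \<alpha> W"
  using \<open>parity_game G \<alpha>\<close>
proof (induction "card (verts G)" arbitrary: G \<alpha> rule: less_induct)
  case less
  note pg = less.prems
  then have G: "game_structure G" by (simp add: parity_game_def)
  define Z where "Z = PSolver G \<alpha>"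
  define G' where "G' = remove G (Z P0 \<union> Z P1)"
  have Zw: "Z i \<subseteq> Win G i (Parity i G \<alpha>)" for i
    using ps pg by (cases i) (auto simp: partial_solver_def Z_def)
  have "subgame_structure G (verts G - (Z P0 \<union> Z P1))"
    using ps pg by (auto simp: partial_solver_def Z_def)
  then have G': "game_structure G'"
    unfolding G'_def remove_def by (rule game_structure_restriction[OF G])
  have vG': "verts G' = verts G - (Z P0 \<union> Z P1)" by (simp add: G'_def verts_remove)
  \<comment> \<open>The condition on the solver enters here: an opponent's edge out of the residual
    game ends in \<open>Z i\<close>, so wins of either player in \<open>G'\<close> carry over to
    \<open>G\<close>.\<close>
  have lift: "Win G' i (Parity i G' \<alpha>) \<subseteq> Win G i (Parity i G \<alpha>)" for i
    unfolding G'_def remove_def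
  proof (rule Win_restriction_subset[OF G prepend_closed_Parity Parity_restriction_subset'])
    fix v v' assume "v \<in> owned G (opponent i)" "v \<in> verts G - (Z P0 \<union> Z P1)"
      "(v, v') \<in> edges G" "v' \<notin> verts G - (Z P0 \<union> Z P1)"
    then have "v' \<in> Z i"
      using esc[OF pg refl, of v v' "opponent i"] by (simp add: Z_def)
    then show "v' \<in> Win G i (Parity i G \<alpha>)" using Zw by blast
  qed
  have Z_verts: "verts G \<subseteq> Z i \<union> Z (opponent i) \<union> verts G'" for i
    unfolding vG' by (cases i) auto
  \<comment> \<open>Covers both calls: \<open>j\<close> and \<open>A\<close> become \<open>i\<close>
    and \<open>U\<close>, then \<open>opponent i\<close> and \<open>W' (opponent i)\<close>.\<close>
  have rec: "\<exists>W. ziel_psolver PSolver H (restrict \<alpha> (verts H)) = Some W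
      \<and> solved H (restrict \<alpha> (verts H)) W"
    if H: "H = remove G' (Attr G' j A)" and A: "A \<subseteq> verts G'" "A \<noteq> {}" for H j A
  proof (rule less.hyps)
    have "game_structure H" unfolding H by (rule game_structure_remove_Attr[OF G'])
    moreover have sub: "verts H \<subseteq> verts G" unfolding H verts_remove vG' by auto
    ultimately show "parity_game H (restrict \<alpha> (verts H))"
      using pg by (rule parity_game_restrict)
    have "A \<subseteq> Attr G' j A" by (rule subset_Attr[OF G' A(1)])
    then have "verts H \<noteq> verts G" using A unfolding H verts_remove vG' by blast
    then show "card (verts H) < card (verts G)"
      using sub G by (intro psubset_card_mono) (auto simp: game_structure_def)
  qed
  show ?case
  proof (cases "verts G = {}")
    case True
    then show ?thesis by (simp add: ziel_psolver.simps solved_def)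
  next
    case ne: False
    show ?thesis
    proof (cases "verts G' = {}")
      case True
      then have "ziel_psolver PSolver G \<alpha> = Some Z"
        using ne by (subst ziel_psolver.simps) (simp add: Let_def Z_def G'_def)
      moreover have "solved G \<alpha> Z"
        using True Zw Z_verts[of P0] by (simp add: solved_def)
      ultimately show ?thesis by blast
    next
      case ne': False
      define p where "p = Max (\<alpha> ` verts G')"
      define i where "i = player_of p"
      define U where "U = {v \<in> verts G'. \<alpha> v = p}"
      define X where "X = Attr G' i U"
      define H where "H = remove G' X"
      have fin: "finite (verts G')" using G' by (simp add: game_structure_def)
      have le: "\<alpha> v \<le> p" if "v \<in> verts G'" for v
        unfolding p_def using that fin by simp
      have "p \<in> \<alpha> ` verts G'" unfolding p_def using fin ne' by (intro Max_in) auto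
      then have Une: "U \<noteq> {}" by (auto simp: U_def)
      have Usub: "U \<subseteq> verts G'" by (auto simp: U_def)
      obtain W' where W': "ziel_psolver PSolver H (restrict \<alpha> (verts H)) = Some W'"
        and S': "solved H (restrict \<alpha> (verts H)) W'"
        using rec[OF H_def[unfolded X_def] Usub Une] by blast
      have unf: "ziel_psolver PSolver G \<alpha> =
        (if W' (opponent i) = {} then Some (Z(i := Z i \<union> W' i \<union> X))
         else let Y = Attr G' (opponent i) (W' (opponent i)); K = remove G' Y
          in do {
               W'' \<leftarrow> ziel_psolver PSolver K (restrict \<alpha> (verts K));
               Some (Z(i := Z i \<union> W'' i, opponent i := Z (opponent i) \<union> W'' (opponent i) \<union> Y))
             })"
        using ne ne' W'
        by (subst ziel_psolver.simps)
          (simp add: Let_def Z_def G'_def p_def i_def U_def X_def H_def)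
      show ?thesis
      proof (cases "W' (opponent i) = {}")
        case True
        \<comment> \<open>As the opponent's set is empty, covering assigns all of \<open>H\<close>
          to player \<open>i\<close>.\<close>
        have "verts H \<subseteq> Win H i (Parity i H (restrict \<alpha> (verts H)))"
          using solvedD[OF S', of i] True by auto
        then have all: "verts G' \<subseteq> Win G' i (Parity i G' \<alpha>)"
          using Win_recurse_opponent_empty[OF G' le U_def, of H] H_def X_def i_def by blast
        have W'sub: "W' i \<subseteq> verts G'"
          using solvedD(1)[OF S', of i] Win_subset_verts[of H i] by (auto simp: H_def verts_remove)
        have Xsub: "X \<subseteq> verts G'" unfolding X_def Attr_def by (rule Win_subset_verts)
        have vH: "verts H = verts G' - X" by (simp add: H_def verts_remove)
        have "solved G \<alpha> (Z(i := Z i \<union> W' i \<union> X))"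
        proof (rule solvedI[where i = i])
          show "(Z(i := Z i \<union> W' i \<union> X)) i \<subseteq> Win G i (Parity i G \<alpha>)"
            using Zw[of i] lift[of i] all W'sub Xsub by auto
          show "verts G \<subseteq> (Z(i := Z i \<union> W' i \<union> X)) i \<union> (Z(i := Z i \<union> W' i \<union> X)) (opponent i)"
            using Z_verts[of i] solvedD(2)[OF S', of i] True vH by auto
        qed (use Zw in simp)
        then show ?thesis using unf True by simp
      next
        case False
        let ?j = "opponent i"
        define Y where "Y = Attr G' ?j (W' ?j)"
        define K where "K = remove G' Y"
        have "W' ?j \<subseteq> Win H ?j (Parity ?j H (restrict \<alpha> (verts H)))"
          using solvedD(1)[OF S'] .
        then have W'j: "W' ?j \<subseteq> Win G' ?j (Parity ?j G' \<alpha>)"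
          using Win_remove_Attr_opponent_subset[OF G' H_def[unfolded X_def], of \<alpha>] by blast
        then have Yw: "Y \<subseteq> Win G' ?j (Parity ?j G' \<alpha>)"
          unfolding Y_def by (intro Attr_Win_subset prepend_closed_Parity)
        have "W' ?j \<subseteq> verts G'" using W'j Win_subset_verts by (rule subset_trans)
        then obtain W'' where W'': "ziel_psolver PSolver K (restrict \<alpha> (verts K)) = Some W''"
          and S'': "solved K (restrict \<alpha> (verts K)) W''"
          using rec[OF K_def[unfolded Y_def] _ False] by blast
        let ?R = "Z(i := Z i \<union> W'' i, ?j := Z ?j \<union> W'' ?j \<union> Y)"
        \<comment> \<open>The attractor removed to form \<open>K\<close> belongs to
          \<open>?j\<close>, so player \<open>i\<close> now has the role of the opponent in the trap
          lemma.\<close>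
        have "W'' i \<subseteq> Win G' i (Parity i G' \<alpha>)"
          using solvedD(1)[OF S'', of i]
            Win_remove_Attr_opponent_subset[OF G' K_def[unfolded Y_def], of \<alpha>] by auto
        moreover have "W'' ?j \<subseteq> Win G' ?j (Parity ?j G' \<alpha>)"
          using solvedD(1)[OF S'', of ?j]
            Win_remove_Attr_subset[OF G' K_def[unfolded Y_def], of \<alpha>] Yw
          by (auto simp: Y_def)
        moreover have "verts K = verts G' - Y" by (simp add: K_def verts_remove)
        ultimately have "solved G \<alpha> ?R"
          using Zw[of i] Zw[of ?j] lift[of i] lift[of ?j] Yw Z_verts[of i] solvedD(2)[OF S'', of i]
          by (intro solvedI[where i = i]) auto
        moreover have "ziel_psolver PSolver G \<alpha> = Some ?R"
          using unf False W'' by (simp add: Let_def Y_def[symmetric] K_def[symmetric])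
        ultimately show ?thesis by blast
      qed
    qed
  qed
qed

theorem proposition4:
  fixes PSolver :: "'v solver"
    and G :: "'v game"
    and \<alpha> :: "'v \<Rightarrow> nat"
  assumes "partial_solver PSolver"
    and "\<And>H \<beta> Vbar v v' i.
           \<lbrakk>parity_game H \<beta>;
            Vbar = verts H - (PSolver H \<beta> P0 \<union> PSolver H \<beta> P1);
            (v, v') \<in> edges H; v \<in> Vbar \<inter> owned H i; v' \<notin> Vbar\<rbrakk>
           \<Longrightarrow> v' \<in> PSolver H \<beta> (opponent i)"
    and "parity_game G \<alpha>"
  shows "\<exists>W. ziel_psolver PSolver G \<alpha> = Some W \<and>
             (\<forall>i. W i = Win G i (Parity i G \<alpha>))"
proof -
  have "\<exists>W. ziel_psolver PSolver G \<alpha> = Some W \<and> solved G \<alpha> W"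
    by (rule ziel_psolver_solved[OF assms(1) _ assms(3)]) (rule assms(2))
  moreover have "game_structure G" using assms(3) by (simp add: parity_game_def)
  ultimately show ?thesis using solved_eq_Win by blast
qed

end
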